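(* Let $X$ be a compact Hausdorff space and $f:X\to X$ be continuous. Suppose that $f$ has shadowing and that $\langle\mathcal U_n\rangle_{n\in\omega}$ is a sequence of finite open covers of $X$ satisfying the following properties: (1) for all $n$, $\mathcal U_{n+1}$ witnesses $\mathcal U_n$-shadowing, i.e. every $\mathcal U_{n+1}$-pseudo-orbit is $\mathcal U_n$-shadowed by some point of $X$; (2) $\{\mathcal U_n\}_{n\in\omega}$ is cofinal in $\mathcal{TOC}(X)$; and (3) for all $n$ and all $U\in\mathcal U_{n+2}$, there exists $W\in\mathcal U_n$ such that $\mathrm{st}(U,\mathcal U_{n+1})\subseteq W$. Then there is an inverse sequence $(g_n^{n+1},X_n)$ of shifts of finite type, with inverse limit system $(\sigma^*,Y)$, $Y=\varprojlim\{g_n^{n+1},X_n\}$, and a semiconjugacy $\phi:(\sigma^*,Y)\to(f,X)$.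
   Context: $\omega=\{0,1,2,\dots\}$; all maps are continuous. A dynamical system $(f,X)$ is a continuous map $f:X\to X$. Shadowing (topological definition). For a finite open cover $\mathcal U$ of $X$, a sequence $\langle x_i\rangle_{i\in\omega}$ in $X$ is a $\mathcal U$-pseudo-orbit if for every $i\in\omega$ there is $U_{i+1}\in\mathcal U$ with $x_{i+1},f(x_i)\in U_{i+1}$. A point $z\in X$ $\mathcal U$-shadows $\langle x_i\rangle$ if for every $i\in\omega$ there is $U_i\in\mathcal U$ with $x_i,f^i(z)\in U_i$. The map $f$ (on a nonempty space $X$) has shadowing if for every finite open cover $\mathcal U$ there is a finite open cover $\mathcal V$ such that every $\mathcal V$-pseudo-orbit is $\mathcal U$-shadowed by a point of $X$. Covers. An open cover $\mathcal U$ is taut if for $U,V\in\mathcal U$, $\overline U\cap\overline V\ne\varnothing$ only if $U\cap V\neq\varnothing$. $\mathcal{TOC}(X)$ is the collection of all finite taut open covers of $X$, ordered by refinement (finer covers are larger). $\{\mathcal U_n\}$ is cofinal in $\mathcal{TOC}(X)$ if it is contained in $\mathcal{TOC}(X)$ and every member of $\mathcal{TOC}(X)$ is refined by some $\mathcal U_n$. For a set $U$ and a cover $\mathcal V$, $\mathrm{st}(U,\mathcal V)=\bigcup\{V\in\mathcal V:V\cap U\neq\varnothing\}$. Shifts of finite type. For a finite set $\Sigma$ (with the discrete topology), $\Sigma^\omega$ carries the product topology and the shift map $\sigma\langle x_i\rangle=\langle x_{i+1}\rangle$. A shift space is a compact $\sigma$-invariant subset of some $\Sigma^\omega$. A shift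 space $Z$ is a shift of finite type over $\Sigma$ if there is a finite collection $\mathcal F$ of finite words in $\Sigma$ such that $\langle x_i\rangle\in\Sigma^\omega$ belongs to $Z$ if and only if $x_ix_{i+1}\cdots x_j\notin\mathcal F$ for all $i\le j$. It is regarded as the dynamical system $(\sigma,Z)$. Inverse limits. An inverse sequence of dynamical systems consists of systems $(f_n,X_n)$, $n\in\omega$, on compact Hausdorff spaces and continuous surjections $g_n^m:X_m\to X_n$ for $n\le m$ with $g_n^n=\mathrm{id}$, $g_n^k=g_n^m\circ g_m^k$ for $n\le m\le k$, and $f_n\circ g_n^m=g_n^m\circ f_m$ for $n\le m$. Its inverse limit is the dynamical system on $\{\langle x_n\rangle\in\prod X_n: x_n=g_n^m(x_m)\ \forall n\le m\}$ (subspace of the product) with the induced map $\langle x_n\rangle\mapsto\langle f_n(x_n)\rangle$; for shifts of finite type this induced map is denoted $\sigma^*$. A semiconjugacy (factor map) $\phi:(g,Y)\to(f,X)$ is a continuous surjection $\phi:Y\to X$ with $\phi\circ g=f\circ\phi$. *)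

theory Defs
  imports "HOL-Analysis.Analysis"
begin

text \<open>Maps are HOL functions on the whole type; only their values on \<^term>\<open>topspace X\<close> matter.\<close>

definition dynamical_system :: "('a \<Rightarrow> 'a) \<Rightarrow> 'a topology \<Rightarrow> bool" where
  "dynamical_system f X \<longleftrightarrow> continuous_map X X f"

definition semiconjugacy ::
  "('b \<Rightarrow> 'b) \<Rightarrow> 'b topology \<Rightarrow> ('a \<Rightarrow> 'a) \<Rightarrow> 'a topology \<Rightarrow> ('b \<Rightarrow> 'a) \<Rightarrow> bool" where
  "semiconjugacy g Y f X \<phi> \<longleftrightarrow>
     continuous_map Y X \<phi> \<and> \<phi> ` topspace Y = topspace X \<and>
     (\<forall>y\<in>topspace Y. \<phi> (g y) = f (\<phi> y))"

definition finite_open_cover :: "'a topology \<Rightarrow> 'a set set \<Rightarrow> bool" where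
  "finite_open_cover X \<U> \<longleftrightarrow>
     finite \<U> \<and> (\<forall>U\<in>\<U>. openin X U) \<and> \<Union>\<U> = topspace X"

definition taut :: "'a topology \<Rightarrow> 'a set set \<Rightarrow> bool" where
  "taut X \<U> \<longleftrightarrow>
     (\<forall>U\<in>\<U>. \<forall>V\<in>\<U>. (X closure_of U) \<inter> (X closure_of V) \<noteq> {} \<longrightarrow> U \<inter> V \<noteq> {})"

definition TOC :: "'a topology \<Rightarrow> 'a set set set" where
  "TOC X = {\<U>. finite_open_cover X \<U> \<and> taut X \<U>}"

definition refines :: "'a set set \<Rightarrow> 'a set set \<Rightarrow> bool" where
  "refines \<V> \<U> \<longleftrightarrow> (\<forall>V\<in>\<V>. \<exists>U\<in>\<U>. V \<subseteq> U)"

definition cofinal_in_TOC :: "'a topology \<Rightarrow> 'a set set set \<Rightarrow> bool" where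
  "cofinal_in_TOC X C \<longleftrightarrow> C \<subseteq> TOC X \<and> (\<forall>\<W>\<in>TOC X. \<exists>\<U>\<in>C. refines \<U> \<W>)"

definition st :: "'a set \<Rightarrow> 'a set set \<Rightarrow> 'a set" where
  "st U \<V> = \<Union>{V \<in> \<V>. V \<inter> U \<noteq> {}}"

definition pseudo_orbit ::
  "'a topology \<Rightarrow> ('a \<Rightarrow> 'a) \<Rightarrow> 'a set set \<Rightarrow> (nat \<Rightarrow> 'a) \<Rightarrow> bool" where
  "pseudo_orbit X f \<U> x \<longleftrightarrow>
     (\<forall>i. x i \<in> topspace X) \<and> (\<forall>i. \<exists>U\<in>\<U>. x (Suc i) \<in> U \<and> f (x i) \<in> U)"

definition shadows ::
  "('a \<Rightarrow> 'a) \<Rightarrow> 'a set set \<Rightarrow> 'a \<Rightarrow> (nat \<Rightarrow> 'a) \<Rightarrow> bool" where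
  "shadows f \<U> z x \<longleftrightarrow> (\<forall>i. \<exists>U\<in>\<U>. x i \<in> U \<and> (f ^^ i) z \<in> U)"

definition witnesses_shadowing ::
  "'a topology \<Rightarrow> ('a \<Rightarrow> 'a) \<Rightarrow> 'a set set \<Rightarrow> 'a set set \<Rightarrow> bool" where
  "witnesses_shadowing X f \<V> \<U> \<longleftrightarrow>
     (\<forall>x. pseudo_orbit X f \<V> x \<longrightarrow> (\<exists>z\<in>topspace X. shadows f \<U> z x))"

definition has_shadowing :: "('a \<Rightarrow> 'a) \<Rightarrow> 'a topology \<Rightarrow> bool" where
  "has_shadowing f X \<longleftrightarrow>
     topspace X \<noteq> {} \<and>
     (\<forall>\<U>. finite_open_cover X \<U> \<longrightarrow>
        (\<exists>\<V>. finite_open_cover X \<V> \<and> witnesses_shadowing X f \<V> \<U>))"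

definition shift_map :: "(nat \<Rightarrow> 's) \<Rightarrow> (nat \<Rightarrow> 's)" where
  "shift_map x = (\<lambda>i. x (Suc i))"

definition full_shift :: "'s set \<Rightarrow> (nat \<Rightarrow> 's) topology" where
  "full_shift \<Sigma> = product_topology (\<lambda>_. discrete_topology \<Sigma>) UNIV"

text \<open>
  Invariance means \<open>\<sigma>(Z) \<subseteq> Z\<close>, not equality: the one-sided shift need not be onto \<open>Z\<close>.
\<close>

definition shift_space :: "'s set \<Rightarrow> (nat \<Rightarrow> 's) set \<Rightarrow> bool" where
  "shift_space \<Sigma> Z \<longleftrightarrow>
     finite \<Sigma> \<and> compactin (full_shift \<Sigma>) Z \<and> shift_map ` Z \<subseteq> Z"

definition shift_of_finite_type :: "'s set \<Rightarrow> (nat \<Rightarrow> 's) set \<Rightarrow> bool" where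
  "shift_of_finite_type \<Sigma> Z \<longleftrightarrow>
     shift_space \<Sigma> Z \<and>
     (\<exists>F. finite F \<and> F \<subseteq> lists \<Sigma> \<and>
        (\<forall>x\<in>topspace (full_shift \<Sigma>). x \<in> Z \<longleftrightarrow> (\<forall>i j. i \<le> j \<longrightarrow> map x [i..<Suc j] \<notin> F)))"

text \<open>The map \<^term>\<open>g n m\<close> goes from the \<open>m\<close>-th space to the \<open>n\<close>-th one, for \<^prop>\<open>n \<le> m\<close>.\<close>

definition inverse_sequence ::
  "(nat \<Rightarrow> 'b topology) \<Rightarrow> (nat \<Rightarrow> 'b \<Rightarrow> 'b) \<Rightarrow> (nat \<Rightarrow> nat \<Rightarrow> 'b \<Rightarrow> 'b) \<Rightarrow> bool" where
  "inverse_sequence X f g \<longleftrightarrow>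
     (\<forall>n. compact_space (X n) \<and> Hausdorff_space (X n) \<and> dynamical_system (f n) (X n)) \<and>
     (\<forall>n m. n \<le> m \<longrightarrow> continuous_map (X m) (X n) (g n m) \<and>
                       g n m ` topspace (X m) = topspace (X n)) \<and>
     (\<forall>n. \<forall>x\<in>topspace (X n). g n n x = x) \<and>
     (\<forall>n m k. n \<le> m \<longrightarrow> m \<le> k \<longrightarrow> (\<forall>x\<in>topspace (X k). g n k x = g n m (g m k x))) \<and>
     (\<forall>n m. n \<le> m \<longrightarrow> (\<forall>x\<in>topspace (X m). f n (g n m x) = g n m (f m x)))"

definition inverse_limit ::
  "(nat \<Rightarrow> 'b topology) \<Rightarrow> (nat \<Rightarrow> nat \<Rightarrow> 'b \<Rightarrow> 'b) \<Rightarrow> (nat \<Rightarrow> 'b) topology" where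
  "inverse_limit X g =
     subtopology (product_topology X UNIV)
       {x \<in> topspace (product_topology X UNIV). \<forall>n m. n \<le> m \<longrightarrow> x n = g n m (x m)}"

definition induced_map :: "(nat \<Rightarrow> 'b \<Rightarrow> 'b) \<Rightarrow> (nat \<Rightarrow> 'b) \<Rightarrow> (nat \<Rightarrow> 'b)" where
  "induced_map f x = (\<lambda>n. f n (x n))"

end

theory Submission
  imports Defs "HOL-Library.Nat_Bijection"
begin

text \<open>
  A point of the \<open>n\<close>-th shift is a stack of symbolic pseudo-orbits \<open>A\<^sub>0, \<dots>, A\<^sub>n\<close>, where \<open>A\<^sub>i(j)\<close> is a
  member of the \<open>(i + 4)\<close>-th cover, \<open>A\<^sub>i(j)\<close> meets the preimage of \<open>A\<^sub>i(j + 1)\<close>, and \<open>A\<^bsub>i+1\<^esub>(j)\<close> meets a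
  fixed \<open>B\<^sub>i(j)\<close> in the \<open>(i + 2)\<close>-nd cover that contains the star of \<open>A\<^sub>i(j)\<close>. All these conditions
  concern two consecutive letters, so the shifts are of finite type. The bonding maps forget the
  top layers. They are onto because shadowing turns \<open>A\<^sub>n\<close> into a true orbit running through the sets
  \<open>B\<^sub>n(j)\<close>, and any itinerary of this orbit can serve as \<open>A\<^bsub>n+1\<^esub>\<close>. (Mapping \<open>A\<^bsub>n+1\<^esub>\<close> to a coarser
  itinerary, without keeping the lower layers, need not be onto.) If \<open>C\<^sub>i(j)\<close> in the \<open>i\<close>-th cover
  contains the star of \<open>B\<^sub>i(j)\<close>, then \<open>C\<^bsub>i+1\<^esub>(j) \<subseteq> C\<^sub>i(j)\<close>, and the semiconjugacy sends a point of the
  inverse limit to the only element of the intersection of the closures of the sets \<open>C\<^sub>i(0)\<close>.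
\<close>

section \<open>One-step shifts of finite type\<close>

definition vertex_shift :: "'s set \<Rightarrow> ('s \<Rightarrow> 's \<Rightarrow> bool) \<Rightarrow> (nat \<Rightarrow> 's) set" where
  "vertex_shift \<Sigma> E = {x. (\<forall>i. x i \<in> \<Sigma>) \<and> (\<forall>i. E (x i) (x (Suc i)))}"

lemma topspace_full_shift: "topspace (full_shift \<Sigma>) = {x. \<forall>i. x i \<in> \<Sigma>}"
  by (auto simp: full_shift_def PiE_def Pi_def)

lemma vertex_shift_subset: "vertex_shift \<Sigma> E \<subseteq> topspace (full_shift \<Sigma>)"
  by (auto simp: vertex_shift_def topspace_full_shift)

lemma topspace_vertex_shift:
  "topspace (subtopology (full_shift \<Sigma>) (vertex_shift \<Sigma> E)) = vertex_shift \<Sigma> E"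
  using vertex_shift_subset[of \<Sigma> E] by (simp add: Int_absorb1)

lemma compact_space_full_shift: "finite \<Sigma> \<Longrightarrow> compact_space (full_shift \<Sigma>)"
  by (simp add: full_shift_def compact_space_product_topology compact_space_discrete_topology)

lemma Hausdorff_space_full_shift: "Hausdorff_space (full_shift \<Sigma>)"
  by (simp add: full_shift_def Hausdorff_space_product_topology)

lemma continuous_map_full_shift_coordinate:
  "continuous_map (full_shift \<Sigma>) (discrete_topology \<Sigma>) (\<lambda>x. x i)"
  unfolding full_shift_def by (rule continuous_map_product_projection) simp

text \<open>Each condition on two consecutive letters describes a finite union of intersections of
  two cylinders, because the alphabet is finite. Cylinders are closed, and the vertex shift is the
  intersection of these sets over all times.\<close>

lemma closedin_vertex_shift:
  assumes "finite \<Sigma>"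
  shows "closedin (full_shift \<Sigma>) (vertex_shift \<Sigma> E)"
proof -
  have cyl: "closedin (full_shift \<Sigma>) {x \<in> topspace (full_shift \<Sigma>). x i \<in> A}" if "A \<subseteq> \<Sigma>" for i A
    using closedin_continuous_map_preimage[OF continuous_map_full_shift_coordinate[of \<Sigma> i], of A] that
    by simp
  have step: "closedin (full_shift \<Sigma>) {x \<in> topspace (full_shift \<Sigma>). E (x i) (x (Suc i))}" for i
  proof -
    have "{x \<in> topspace (full_shift \<Sigma>). E (x i) (x (Suc i))} =
      (\<Union>a\<in>\<Sigma>. {x \<in> topspace (full_shift \<Sigma>). x i \<in> {a}} \<inter>
               {x \<in> topspace (full_shift \<Sigma>). x (Suc i) \<in> {b \<in> \<Sigma>. E a b}})"
      by (auto simp: topspace_full_shift)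
    also have "closedin (full_shift \<Sigma>) \<dots>"
    proof (rule closedin_Union)
      fix T
      assume "T \<in> (\<lambda>a. {x \<in> topspace (full_shift \<Sigma>). x i \<in> {a}} \<inter>
               {x \<in> topspace (full_shift \<Sigma>). x (Suc i) \<in> {b \<in> \<Sigma>. E a b}}) ` \<Sigma>"
      then obtain a where "a \<in> \<Sigma>" and
          T: "T = {x \<in> topspace (full_shift \<Sigma>). x i \<in> {a}} \<inter>
               {x \<in> topspace (full_shift \<Sigma>). x (Suc i) \<in> {b \<in> \<Sigma>. E a b}}"
        by (elim imageE)
      show "closedin (full_shift \<Sigma>) T"
        unfolding T using \<open>a \<in> \<Sigma>\<close> by (intro closedin_Int cyl) simp_all
    qed (use assms in simp)
    finally show ?thesis .
  qed
  have "vertex_shift \<Sigma> E = (\<Inter>i. {x \<in> topspace (full_shift \<Sigma>). E (x i) (x (Suc i))})"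
    by (auto simp: vertex_shift_def topspace_full_shift)
  also have "closedin (full_shift \<Sigma>) \<dots>"
    using step by (intro closedin_Inter) auto
  finally show ?thesis .
qed

lemma shift_map_vertex_shift: "x \<in> vertex_shift \<Sigma> E \<Longrightarrow> shift_map x \<in> vertex_shift \<Sigma> E"
  by (auto simp: vertex_shift_def shift_map_def)

text \<open>The forbidden words are the two-letter non-edges. A factor
  \<open>map x [i..<Suc j]\<close> has length two only for \<open>j = Suc i\<close>, so forbidding
  them tests exactly the consecutive pairs.\<close>

lemma shift_of_finite_type_vertex_shift:
  assumes "finite \<Sigma>"
  shows "shift_of_finite_type \<Sigma> (vertex_shift \<Sigma> E)"
proof -
  define F where "F = {[a, b] |a b. a \<in> \<Sigma> \<and> b \<in> \<Sigma> \<and> \<not> E a b}"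
  have "F \<subseteq> (\<lambda>(a, b). [a, b]) ` (\<Sigma> \<times> \<Sigma>)"
    by (auto simp: F_def)
  then have "finite F"
    using assms by (meson finite_SigmaI finite_imageI finite_subset)
  moreover have "F \<subseteq> lists \<Sigma>"
    by (auto simp: F_def)
  moreover have "x \<in> vertex_shift \<Sigma> E \<longleftrightarrow> (\<forall>i j. i \<le> j \<longrightarrow> map x [i..<Suc j] \<notin> F)"
    if x: "x \<in> topspace (full_shift \<Sigma>)" for x
  proof
    assume "x \<in> vertex_shift \<Sigma> E"
    then have E: "E (x i) (x (Suc i))" for i
      by (simp add: vertex_shift_def)
    show "\<forall>i j. i \<le> j \<longrightarrow> map x [i..<Suc j] \<notin> F"
    proof (intro allI impI notI)
      fix i j :: nat
      assume "i \<le> j" and w: "map x [i..<Suc j] \<in> F"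
      then obtain a b where "map x [i..<Suc j] = [a, b]"
        by (auto simp: F_def simp del: upt_Suc)
      then have "length (map x [i..<Suc j]) = length [a, b]"
        by (simp only:)
      then have "j = Suc i"
        using \<open>i \<le> j\<close> by (simp del: upt_Suc)
      with w E show False
        by (auto simp: F_def)
    qed
  next
    assume *: "\<forall>i j. i \<le> j \<longrightarrow> map x [i..<Suc j] \<notin> F"
    have "E (x i) (x (Suc i))" for i
      using *[rule_format, of i "Suc i"] x by (auto simp: F_def topspace_full_shift)
    with x show "x \<in> vertex_shift \<Sigma> E"
      by (simp add: vertex_shift_def topspace_full_shift)
  qed
  moreover have "shift_space \<Sigma> (vertex_shift \<Sigma> E)"
    using assms shift_map_vertex_shift
    by (auto simp: shift_space_def intro!: closedin_compact_space compact_space_full_shift closedin_vertex_shift)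
  ultimately show ?thesis
    unfolding shift_of_finite_type_def by (intro conjI exI[of _ F] ballI)
qed

lemma continuous_map_letterwise:
  assumes "h ` \<Sigma> \<subseteq> \<Sigma>'"
  shows "continuous_map (full_shift \<Sigma>) (full_shift \<Sigma>') (\<lambda>x j. h (x j))"
  unfolding full_shift_def[of \<Sigma>'] continuous_map_componentwise_UNIV
proof
  fix j
  have "continuous_map (discrete_topology \<Sigma>) (discrete_topology \<Sigma>') h"
    using assms by (simp add: image_subset_iff_funcset)
  from continuous_map_compose[OF continuous_map_full_shift_coordinate[of \<Sigma> j] this]
  show "continuous_map (full_shift \<Sigma>) (discrete_topology \<Sigma>') (\<lambda>x. h (x j))"
    by (simp add: o_def)
qed

lemma continuous_map_shift_map: "continuous_map (full_shift \<Sigma>) (full_shift \<Sigma>) shift_map"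
  unfolding full_shift_def[of \<Sigma>] continuous_map_componentwise_UNIV
  using continuous_map_full_shift_coordinate[of \<Sigma>]
  by (auto simp: shift_map_def full_shift_def)

section \<open>Taut covers that separate points\<close>

text \<open>Cofinality speaks of taut covers only, so the separating cover has to be taut. Normality
  gives neighbourhoods of the two points with disjoint closures. The complements of these closures
  cover the space, and the closure of each complement misses the corresponding open
  neighbourhood.\<close>

lemma separating_taut_cover:
  assumes "compact_space X" "Hausdorff_space X" "x \<in> topspace X" "y \<in> topspace X" "x \<noteq> y"
  obtains \<W> where "\<W> \<in> TOC X" "\<And>W. W \<in> \<W> \<Longrightarrow> x \<notin> X closure_of W \<or> y \<notin> X closure_of W"
proof -
  have "\<exists>O1 O2. openin X O1 \<and> openin X O2 \<and> x \<in> O1 \<and> y \<in> O2 \<and>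
      disjnt (X closure_of O1) (X closure_of O2)"
  proof -
    have "normal_space X"
      using assms by (simp add: compact_Hausdorff_or_regular_imp_normal_space)
    moreover have "closedin X {x}" "closedin X {y}"
      using assms by (auto intro: closedin_Hausdorff_singleton)
    moreover have "disjnt {x} {y}"
      using assms(5) by simp
    ultimately obtain O1 O2 where "openin X O1" "openin X O2" "{x} \<subseteq> O1" "{y} \<subseteq> O2"
        "disjnt (X closure_of O1) (X closure_of O2)"
      using normal_space_disjoint_closures[of X] by metis
    then show ?thesis by blast
  qed
  then obtain O1 O2 where O: "openin X O1" "openin X O2" "x \<in> O1" "y \<in> O2"
      "X closure_of O1 \<inter> X closure_of O2 = {}"
    by (auto simp: disjnt_def)
  define A where "A = topspace X - X closure_of O1"
  define B where "B = topspace X - X closure_of O2"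
  have op: "openin X A" "openin X B"
    by (auto simp: A_def B_def)
  have AB: "A \<union> B = topspace X"
    using O(5) by (auto simp: A_def B_def)
  have "X closure_of A \<inter> X closure_of B = {}" if "A \<inter> B = {}"
  proof -
    have "A = topspace X - B" "B = topspace X - A"
      using that AB by auto
    then have "closedin X A" "closedin X B"
      using op by (metis closedin_diff closedin_topspace)+
    then show ?thesis
      using that by (simp add: closure_of_closedin)
  qed
  \<comment> \<open>Tautness of the pair: disjoint \<open>A\<close> and \<open>B\<close> would be clopen.\<close>
  then have "{A, B} \<in> TOC X"
    using op AB by (auto simp: TOC_def finite_open_cover_def taut_def)
  moreover have "x \<notin> X closure_of A"
    using O(1,3) closure_of_subset[OF openin_subset[OF O(1)]]
    by (auto simp: A_def in_closure_of)
  moreover have "y \<notin> X closure_of B"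
    using O(2,4) closure_of_subset[OF openin_subset[OF O(2)]]
    by (auto simp: B_def in_closure_of)
  ultimately show thesis
    by (intro that[of "{A, B}"]) auto
qed

section \<open>Stars and nested members of the covers\<close>

text \<open>Here \<open>w\<close> is a choice function for the star condition, and
  \<open>V i\<close> names the members of a cover by natural numbers, possibly with repetition. The
  offset 4 leaves room for two applications of \<open>w\<close>, each of which lowers the level by
  2.\<close>

locale shadowing_covers =
  fixes X :: "'a topology" and f :: "'a \<Rightarrow> 'a" and \<U> :: "nat \<Rightarrow> 'a set set"
    and w :: "nat \<Rightarrow> 'a set \<Rightarrow> 'a set"
    and V :: "nat \<Rightarrow> nat \<Rightarrow> 'a set" and K :: "nat \<Rightarrow> nat set"
  assumes compact: "compact_space X" and Hausdorff: "Hausdorff_space X"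
    and cont: "continuous_map X X f"
    and cover: "finite_open_cover X (\<U> n)"
    and witness: "witnesses_shadowing X f (\<U> (Suc n)) (\<U> n)"
    and cofinal: "cofinal_in_TOC X (range \<U>)"
    and w_mem: "U \<in> \<U> (Suc (Suc n)) \<Longrightarrow> w n U \<in> \<U> n"
    and st_w: "U \<in> \<U> (Suc (Suc n)) \<Longrightarrow> st U (\<U> (Suc n)) \<subseteq> w n U"
    and finite_K: "finite (K i)"
    and V_image: "V i ` K i = \<U> (i + 4)"
begin

lemma mem_subset: "U \<in> \<U> n \<Longrightarrow> U \<subseteq> topspace X"
  using cover[of n] by (auto simp: finite_open_cover_def)

lemma covered: "x \<in> topspace X \<Longrightarrow> \<exists>U\<in>\<U> n. x \<in> U"
  using cover[of n] by (auto simp: finite_open_cover_def)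

text \<open>A subset of the space lies in its own star, since the sets that form the star come from
  a cover.\<close>

lemma subset_w: "U \<in> \<U> (Suc (Suc n)) \<Longrightarrow> U \<subseteq> w n U"
  using st_w[of U n] mem_subset[of U "Suc (Suc n)"] covered[of _ "Suc n"] by (fastforce simp: st_def)

lemma V_mem: "k \<in> K i \<Longrightarrow> V i k \<in> \<U> (i + 4)"
  using V_image by blast

lemma V_covered: "x \<in> topspace X \<Longrightarrow> \<exists>k\<in>K i. x \<in> V i k"
  using covered[of x "i + 4"] V_image[of i] by (metis imageE)

lemma iter_mem: "x \<in> topspace X \<Longrightarrow> (f ^^ j) x \<in> topspace X"
  using cont by (induction j) (auto simp: continuous_map_def Pi_def)

definition B :: "nat \<Rightarrow> nat \<Rightarrow> 'a set" where
  "B i k = w (i + 2) (V i k)"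

definition C :: "nat \<Rightarrow> nat \<Rightarrow> 'a set" where
  "C i k = w i (B i k)"

definition E :: "nat \<Rightarrow> nat \<Rightarrow> nat \<Rightarrow> bool" where
  "E i a b \<longleftrightarrow> (\<exists>x\<in>V i a. f x \<in> V i b)"

definition R :: "nat \<Rightarrow> nat \<Rightarrow> nat \<Rightarrow> bool" where
  "R i a b \<longleftrightarrow> V (Suc i) b \<inter> B i a \<noteq> {}"

lemma B_mem: "k \<in> K i \<Longrightarrow> B i k \<in> \<U> (i + 2)"
  using V_mem[of k i] w_mem[of "V i k" "i + 2"] by (simp add: B_def eval_nat_numeral)

lemma C_mem: "k \<in> K i \<Longrightarrow> C i k \<in> \<U> i"
  using B_mem[of k i] w_mem[of "B i k" i] by (simp add: C_def eval_nat_numeral)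

lemma st_V_subset_B: "k \<in> K i \<Longrightarrow> st (V i k) (\<U> (i + 3)) \<subseteq> B i k"
  using V_mem[of k i] st_w[of "V i k" "i + 2"] by (simp add: B_def eval_nat_numeral)

lemma V_subset_B: "k \<in> K i \<Longrightarrow> V i k \<subseteq> B i k"
  using V_mem[of k i] subset_w[of "V i k" "i + 2"] by (simp add: B_def eval_nat_numeral)

lemma V_subset_C: "k \<in> K i \<Longrightarrow> V i k \<subseteq> C i k"
  using V_subset_B[of k i] B_mem[of k i] subset_w[of "B i k" i]
  by (auto simp: C_def eval_nat_numeral)

text \<open>The set \<open>C (Suc i) k'\<close> contains \<open>V (Suc i) k'\<close> and so meets
  \<open>B i k\<close> by \<open>R\<close>. As a member of the cover at level \<open>Suc i\<close>
  it belongs to the star of \<open>B i k\<close>, which lies in \<open>C i k\<close>.\<close>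

lemma C_nested:
  assumes "k \<in> K i" "k' \<in> K (Suc i)" "R i k k'"
  shows "C (Suc i) k' \<subseteq> C i k"
proof -
  have "C (Suc i) k' \<inter> B i k \<noteq> {}"
    using assms V_subset_C[of k' "Suc i"] by (auto simp: R_def)
  then have "C (Suc i) k' \<subseteq> st (B i k) (\<U> (Suc i))"
    using C_mem[OF assms(2)] by (auto simp: st_def)
  also have "\<dots> \<subseteq> C i k"
    using B_mem[OF assms(1)] st_w[of "B i k" i] by (simp add: C_def eval_nat_numeral)
  finally show ?thesis .
qed

section \<open>Threads of indices and their limit points\<close>

text \<open>A point of the inverse limit, read at one fixed time, gives such a sequence with one
  index for every level.\<close>

definition thread :: "(nat \<Rightarrow> nat) \<Rightarrow> bool" where
  "thread k \<longleftrightarrow> (\<forall>i. k i \<in> K i \<and> R i (k i) (k (Suc i)))"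

abbreviation clC :: "(nat \<Rightarrow> nat) \<Rightarrow> nat \<Rightarrow> 'a set" where
  "clC k i \<equiv> X closure_of C i (k i)"

lemma thread_antimono:
  assumes "thread k" "i \<le> i'"
  shows "clC k i' \<subseteq> clC k i"
proof (rule lift_Suc_antimono_le[of "clC k", OF _ assms(2)])
  fix n
  show "clC k (Suc n) \<subseteq> clC k n"
    using assms(1) by (intro closure_of_mono C_nested) (simp_all add: thread_def)
qed

text \<open>Two distinct points are separated by a taut cover, which some \<open>\<U> n\<close>
  refines by cofinality. Then \<open>C n (k n)\<close> lies in a member whose closure misses one of
  the two points.\<close>

lemma clC_unique:
  assumes "thread k" "\<And>i. x \<in> clC k i" "\<And>i. y \<in> clC k i"
  shows "x = y"
proof (rule ccontr)
  assume "x \<noteq> y"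
  have "x \<in> topspace X" "y \<in> topspace X"
    using assms(2,3)[of 0] closure_of_subset_topspace by (metis subsetD)+
  with \<open>x \<noteq> y\<close> obtain \<W> where W: "\<W> \<in> TOC X"
      "\<And>W. W \<in> \<W> \<Longrightarrow> x \<notin> X closure_of W \<or> y \<notin> X closure_of W"
    using separating_taut_cover[OF compact Hausdorff] by metis
  then obtain n where "refines (\<U> n) \<W>"
    using cofinal by (auto simp: cofinal_in_TOC_def)
  then obtain W where "W \<in> \<W>" "C n (k n) \<subseteq> W"
    using C_mem[of "k n" n] assms(1) by (auto simp: refines_def thread_def)
  then show False
    using W(2) assms(2,3)[of n] closure_of_mono by blast
qed

text \<open>The parts of the nested closed sets outside \<open>G\<close> decrease to the empty set,
  so by compactness one of them is already empty.\<close>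

lemma clC_eventually:
  assumes "thread k" "openin X G" "(\<Inter>i. clC k i) \<subseteq> G"
  shows "\<exists>i. \<forall>i'\<ge>i. clC k i' \<subseteq> G"
proof -
  have "\<exists>i. clC k i \<inter> (topspace X - G) = {}"
  proof (rule ccontr)
    assume ne: "\<not> ?thesis"
    have "(\<Inter>i. clC k i \<inter> (topspace X - G)) \<noteq> {}"
    proof (rule compact_space_imp_nest[OF compact])
      show "decseq (\<lambda>i. clC k i \<inter> (topspace X - G))"
        using thread_antimono[OF assms(1)] by (fastforce simp: decseq_def)
    qed (use assms(2) ne in \<open>auto intro!: closedin_Int closedin_diff\<close>)
    then show False
      using assms(3) by auto
  qed
  then obtain i where "clC k i \<subseteq> G"
    using closure_of_subset_topspace[of X] by blast
  then show ?thesis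
    using thread_antimono[OF assms(1), of i] by blast
qed

definition pt :: "(nat \<Rightarrow> nat) \<Rightarrow> 'a" where
  "pt k = (THE x. \<forall>i. x \<in> clC k i)"

lemma pt_eqI: "thread k \<Longrightarrow> (\<And>i. x \<in> clC k i) \<Longrightarrow> pt k = x"
  unfolding pt_def using clC_unique by (intro the_equality) blast+

lemma pt_eqI_V:
  assumes "thread k" "\<And>i. x \<in> V i (k i)"
  shows "pt k = x"
proof (rule pt_eqI[OF assms(1)])
  fix i
  have "k i \<in> K i"
    using assms(1) by (simp add: thread_def)
  then show "x \<in> clC k i"
    using V_subset_C[of "k i" i] assms(2)[of i] closure_of_subset[OF mem_subset[OF C_mem]] by blast
qed

text \<open>Each closure contains the nonempty set \<open>V i (k i)\<close>, so compactness gives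
  the nested closures a common point.\<close>

lemma pt_mem:
  assumes "thread k" and ne: "\<And>i. V i (k i) \<noteq> {}"
  shows "pt k \<in> clC k i"
proof -
  have "(\<Inter>i. clC k i) \<noteq> {}"
  proof (rule compact_space_imp_nest[OF compact])
    show "decseq (clC k)"
      using thread_antimono[OF assms(1)] by (simp add: decseq_def)
    fix i
    have "k i \<in> K i"
      using assms(1) by (simp add: thread_def)
    then show "clC k i \<noteq> {}"
      using V_subset_C[of "k i" i] ne[of i] closure_of_subset[OF mem_subset[OF C_mem]] by blast
  qed auto
  then obtain x where "\<And>i. x \<in> clC k i"
    by blast
  with pt_eqI[OF assms(1) this] show ?thesis
    by simp
qed

lemma Inter_clC:
  assumes "thread k" "\<And>i. V i (k i) \<noteq> {}"
  shows "(\<Inter>i. clC k i) = {pt k}"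
  using pt_mem[OF assms] pt_eqI[OF assms(1)] by auto

lemma pt_eventually:
  assumes "thread k" "\<And>i. V i (k i) \<noteq> {}" "openin X G" "pt k \<in> G"
  shows "\<exists>i. \<forall>i'\<ge>i. clC k i' \<subseteq> G"
  using clC_eventually[OF assms(1,3)] Inter_clC[OF assms(1,2)] assms(4) by simp

lemma E_nonempty: "E i a b \<Longrightarrow> V i a \<noteq> {}" "E i a b \<Longrightarrow> V i b \<noteq> {}"
  by (auto simp: E_def)

lemma pt_in_topspace:
  assumes "thread k" "\<And>i. V i (k i) \<noteq> {}"
  shows "pt k \<in> topspace X"
  using pt_mem[OF assms, of 0] closure_of_subset_topspace by (metis subsetD)

text \<open>At a high level the edge condition gives a point near \<open>pt a\<close> whose image is
  near \<open>pt b\<close>. If \<open>f (pt a)\<close> and \<open>pt b\<close> differed, continuity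
  would also place this image in a disjoint neighbourhood of \<open>f (pt a)\<close>.\<close>

lemma pt_equivariant:
  assumes "thread a" "thread b" "\<And>i. E i (a i) (b i)"
  shows "pt b = f (pt a)"
proof (rule ccontr)
  assume "pt b \<noteq> f (pt a)"
  have ne: "V i (a i) \<noteq> {}" "V i (b i) \<noteq> {}" for i
    using E_nonempty assms(3) by blast+
  have "f (pt a) \<in> topspace X"
    using pt_in_topspace[OF assms(1) ne(1)] cont by (auto simp: continuous_map_def)
  then obtain G H where GH: "openin X G" "openin X H" "pt b \<in> G" "f (pt a) \<in> H" "disjnt G H"
    using Hausdorff pt_in_topspace[OF assms(2) ne(2)] \<open>pt b \<noteq> f (pt a)\<close>
    unfolding Hausdorff_space_def by metis
  define H' where "H' = {x \<in> topspace X. f x \<in> H}"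
  have "openin X H'"
    unfolding H'_def using cont GH(2) by (rule openin_continuous_map_preimage)
  moreover have "pt a \<in> H'"
    using GH(4) pt_in_topspace[OF assms(1) ne(1)] by (simp add: H'_def)
  ultimately obtain i where i: "\<And>i'. i \<le> i' \<Longrightarrow> clC a i' \<subseteq> H'"
    using pt_eventually[OF assms(1) ne(1)] by meson
  obtain j where j: "\<And>i'. j \<le> i' \<Longrightarrow> clC b i' \<subseteq> G"
    using pt_eventually[OF assms(2) ne(2) GH(1,3)] by meson
  define m where "m = max i j"
  obtain x where x: "x \<in> V m (a m)" "f x \<in> V m (b m)"
    using assms(3) by (auto simp: E_def)
  have V_clC: "V m (k m) \<subseteq> clC k m" if "thread k" for k
    using that V_subset_C[of "k m" m] closure_of_subset[OF mem_subset[OF C_mem[of "k m" m]]]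
    by (auto simp: thread_def)
  have "f x \<in> H"
    using x(1) V_clC[OF assms(1)] i[of m] by (auto simp: m_def H'_def)
  moreover have "f x \<in> G"
    using x(2) V_clC[OF assms(2)] j[of m] by (auto simp: m_def)
  ultimately show False
    using GH(5) by (auto simp: disjnt_iff)
qed

section \<open>Encoded alphabets, shifts and bonding maps\<close>

text \<open>
  The alphabets must be sets of natural numbers, so a letter of the \<open>n\<close>-th shift is the
  \<^const>\<open>list_encode\<close> code of a word whose \<open>i\<close>-th entry is an index of the set \<open>A\<^sub>i\<close>.
\<close>

definition word :: "nat \<Rightarrow> nat list \<Rightarrow> bool" where
  "word n l \<longleftrightarrow> length l = Suc n \<and> (\<forall>i\<le>n. l ! i \<in> K i) \<and> (\<forall>i<n. R i (l ! i) (l ! Suc i))"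

definition Sig :: "nat \<Rightarrow> nat set" where
  "Sig n = {c. word n (list_decode c)}"

definition step :: "nat \<Rightarrow> nat \<Rightarrow> nat \<Rightarrow> bool" where
  "step n c d \<longleftrightarrow> (\<forall>i\<le>n. E i (list_decode c ! i) (list_decode d ! i))"

definition Z :: "nat \<Rightarrow> (nat \<Rightarrow> nat) set" where
  "Z n = vertex_shift (Sig n) (step n)"

definition trunc :: "nat \<Rightarrow> nat \<Rightarrow> nat" where
  "trunc n c = list_encode (take (Suc n) (list_decode c))"

lemma finite_Sig: "finite (Sig n)"
proof -
  have "Collect (word n) \<subseteq> {l. set l \<subseteq> (\<Union>i\<le>n. K i) \<and> length l = Suc n}"
    by (fastforce simp: word_def in_set_conv_nth less_Suc_eq_le)
  then have "finite (Collect (word n))"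
    by (rule finite_subset) (auto intro!: finite_lists_length_eq finite_K)
  moreover have "Sig n = list_encode ` Collect (word n)"
    by (auto simp: Sig_def image_iff) (metis list_decode_inverse)
  ultimately show ?thesis
    by simp
qed

lemma trunc_Sig: "n \<le> m \<Longrightarrow> c \<in> Sig m \<Longrightarrow> trunc n c \<in> Sig n"
  by (auto simp: Sig_def trunc_def word_def)

lemma trunc_id: "c \<in> Sig n \<Longrightarrow> trunc n c = c"
  by (auto simp: Sig_def trunc_def word_def)

lemma trunc_trunc: "n \<le> m \<Longrightarrow> trunc n (trunc m c) = trunc n c"
  by (simp add: trunc_def min_def)

lemma step_trunc: "n \<le> m \<Longrightarrow> step m c d \<Longrightarrow> step n (trunc n c) (trunc n d)"
  by (auto simp: step_def trunc_def)

definition g :: "nat \<Rightarrow> nat \<Rightarrow> (nat \<Rightarrow> nat) \<Rightarrow> (nat \<Rightarrow> nat)" where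
  "g n m x = (\<lambda>j. trunc n (x j))"

lemma g_Z: "n \<le> m \<Longrightarrow> x \<in> Z m \<Longrightarrow> g n m x \<in> Z n"
  by (auto simp: Z_def vertex_shift_def g_def intro: trunc_Sig step_trunc)

section \<open>Surjectivity of the bonding maps\<close>

text \<open>Any itinerary of a true orbit satisfies the edge condition, with the orbit points
  themselves as witnesses.\<close>

lemma orbit_letters:
  assumes "z \<in> topspace X"
  obtains k where "\<And>j. k j \<in> K i" "\<And>j. (f ^^ j) z \<in> V i (k j)" "\<And>j. E i (k j) (k (Suc j))"
proof -
  have "\<forall>j. \<exists>k\<in>K i. (f ^^ j) z \<in> V i k"
    using V_covered iter_mem[OF assms] by blast
  then obtain k where k: "\<And>j. k j \<in> K i" "\<And>j. (f ^^ j) z \<in> V i (k j)"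
    by metis
  moreover have "E i (k j) (k (Suc j))" for j
    using k(2)[of j] k(2)[of "Suc j"] by (auto simp: E_def)
  ultimately show thesis
    using that by blast
qed

text \<open>Witnesses of the edges form a pseudo-orbit for the cover at level \<open>i + 4\<close>.
  A point that shadows it at level \<open>i + 3\<close> has its orbit in the stars of the sets
  \<open>V i (a j)\<close>, hence in the sets \<open>B i (a j)\<close>.\<close>

lemma shadowed_by_B:
  assumes "\<And>j. a j \<in> K i" "\<And>j. E i (a j) (a (Suc j))"
  obtains z where "z \<in> topspace X" "\<And>j. (f ^^ j) z \<in> B i (a j)"
proof -
  obtain x where x: "\<And>j. x j \<in> V i (a j)" "\<And>j. f (x j) \<in> V i (a (Suc j))"
    using assms(2) unfolding E_def by metis
  have "pseudo_orbit X f (\<U> (i + 4)) x"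
    unfolding pseudo_orbit_def
  proof (intro conjI allI)
    fix j
    show "x j \<in> topspace X"
      using x(1)[of j] mem_subset[OF V_mem[OF assms(1)[of j]]] by blast
    show "\<exists>U\<in>\<U> (i + 4). x (Suc j) \<in> U \<and> f (x j) \<in> U"
      using x(1)[of "Suc j"] x(2)[of j] V_mem[OF assms(1)[of "Suc j"]] by blast
  qed
  then obtain z where z: "z \<in> topspace X" "shadows f (\<U> (i + 3)) z x"
    using witness[of "i + 3"] by (auto simp: witnesses_shadowing_def eval_nat_numeral)
  have "(f ^^ j) z \<in> B i (a j)" for j
  proof -
    obtain U where "U \<in> \<U> (i + 3)" "x j \<in> U" "(f ^^ j) z \<in> U"
      using z(2) by (auto simp: shadows_def)
    then have "(f ^^ j) z \<in> st (V i (a j)) (\<U> (i + 3))"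
      using x(1)[of j] by (auto simp: st_def)
    then show ?thesis
      using st_V_subset_B assms(1) by blast
  qed
  then show thesis
    using that z(1) by blast
qed

lemma g_Suc_onto:
  assumes "x \<in> Z n"
  shows "\<exists>y\<in>Z (Suc n). g n (Suc n) y = x"
proof -
  have wd: "word n (list_decode (x j))" and sp: "step n (x j) (x (Suc j))" for j
    using assms by (auto simp: Z_def vertex_shift_def Sig_def)
  \<comment> \<open>Among the old layers, \<open>R\<close> ties the new one only to layer
    \<open>n\<close>, so it suffices to shadow this top layer.\<close>
  define a where "a j = list_decode (x j) ! n" for j
  have "a j \<in> K n" "E n (a j) (a (Suc j))" for j
    using wd[of j] sp[of j] by (auto simp: a_def word_def step_def)
  then obtain z where z: "z \<in> topspace X" "\<And>j. (f ^^ j) z \<in> B n (a j)"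
    using shadowed_by_B by metis
  obtain k where k: "\<And>j. k j \<in> K (Suc n)" "\<And>j. (f ^^ j) z \<in> V (Suc n) (k j)"
      "\<And>j. E (Suc n) (k j) (k (Suc j))"
    using orbit_letters[OF z(1)] by metis
  have R: "R n (a j) (k j)" for j
    using z(2) k(2) by (auto simp: R_def)
  define y where "y j = list_encode (list_decode (x j) @ [k j])" for j
  have len: "length (list_decode (x j)) = Suc n" for j
    using wd[of j] by (simp add: word_def)
  have "word (Suc n) (list_decode (y j))" for j
    using wd[of j] R[of j] k(1)[of j]
    by (auto simp: word_def y_def nth_append a_def less_Suc_eq le_Suc_eq)
  moreover have "step (Suc n) (y j) (y (Suc j))" for j
    using sp[of j] k(3)[of j] len
    by (auto simp: step_def y_def nth_append le_Suc_eq)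
  ultimately have "y \<in> Z (Suc n)"
    by (simp add: Z_def vertex_shift_def Sig_def)
  moreover have "g n (Suc n) y = x"
    by (auto simp: g_def trunc_def y_def len)
  ultimately show ?thesis
    by blast
qed

lemma g_onto:
  assumes "n \<le> m" "x \<in> Z n"
  shows "\<exists>y\<in>Z m. g n m y = x"
  using assms(1)
proof (induction m rule: dec_induct)
  case base
  have "g n n x = x"
    using assms(2) by (auto simp: g_def Z_def vertex_shift_def trunc_id)
  then show ?case
    using assms(2) by blast
next
  case (step m)
  then obtain y where y: "y \<in> Z m" "g n m y = x"
    by blast
  obtain y' where "y' \<in> Z (Suc m)" "g m (Suc m) y' = y"
    using g_Suc_onto[OF y(1)] by blast
  moreover from this have "g n (Suc m) y' = x"
    using y(2) step(1) trunc_trunc by (auto simp: g_def)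
  ultimately show ?case
    by blast
qed

section \<open>The inverse sequence and its limit\<close>

abbreviation ZT :: "nat \<Rightarrow> (nat \<Rightarrow> nat) topology" where
  "ZT n \<equiv> subtopology (full_shift (Sig n)) (Z n)"

lemma topspace_ZT: "topspace (ZT n) = Z n"
  by (simp only: Z_def topspace_vertex_shift)

lemma continuous_map_g:
  assumes "n \<le> m"
  shows "continuous_map (ZT m) (ZT n) (g n m)"
proof -
  have "continuous_map (full_shift (Sig m)) (full_shift (Sig n)) (g n m)"
    using continuous_map_letterwise[of "trunc n" "Sig m" "Sig n"] trunc_Sig[OF assms]
    by (auto simp: g_def[abs_def])
  then show ?thesis
    using g_Z[OF assms] topspace_ZT
    by (auto simp: continuous_map_in_subtopology continuous_map_from_subtopology)
qed

lemma inverse_sequence_ZT: "inverse_sequence ZT (\<lambda>n. shift_map) g"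
  unfolding inverse_sequence_def topspace_ZT
proof (intro conjI allI impI ballI)
  fix n
  show "compact_space (ZT n)"
    unfolding Z_def
    by (intro compact_space_subtopology closedin_compact_space compact_space_full_shift
        closedin_vertex_shift finite_Sig)
  show "Hausdorff_space (ZT n)"
    by (intro Hausdorff_space_subtopology Hausdorff_space_full_shift)
  show "dynamical_system shift_map (ZT n)"
    using continuous_map_shift_map[of "Sig n"] shift_map_vertex_shift topspace_ZT[of n]
    by (auto simp: dynamical_system_def continuous_map_in_subtopology
        continuous_map_from_subtopology Z_def)
  show "g n n x = x" if "x \<in> Z n" for x
    using that by (auto simp: g_def Z_def vertex_shift_def trunc_id)
next
  fix n m :: nat
  assume "n \<le> m"
  then show "continuous_map (ZT m) (ZT n) (g n m)"
    by (rule continuous_map_g)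
  show "g n m ` Z m = Z n"
    using g_Z[OF \<open>n \<le> m\<close>] g_onto[OF \<open>n \<le> m\<close>] by blast
  show "shift_map (g n m x) = g n m (shift_map x)" for x
    by (simp add: g_def shift_map_def)
  show "g n k x = g n m (g m k x)" for x k
    using \<open>n \<le> m\<close> by (simp add: g_def trunc_trunc)
qed

text \<open>This is a diagonal reading: layer \<open>i\<close> is the last entry of the words in
  coordinate \<open>i\<close>. In a point of the inverse limit every later coordinate shows the same
  entry.\<close>

definition letter :: "nat \<Rightarrow> (nat \<Rightarrow> nat \<Rightarrow> nat) \<Rightarrow> nat \<Rightarrow> nat" where
  "letter j y i = list_decode (y i j) ! i"

lemma topspace_inverse_limit:
  "topspace (inverse_limit ZT g) = {y. (\<forall>n. y n \<in> Z n) \<and> (\<forall>n m. n \<le> m \<longrightarrow> y n = g n m (y m))}"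
proof -
  have "y \<in> topspace (product_topology ZT UNIV) \<longleftrightarrow> (\<forall>n. y n \<in> Z n)" for y
    unfolding topspace_product_topology PiE_UNIV_domain Pi_iff o_apply topspace_ZT by simp
  then show ?thesis
    unfolding inverse_limit_def topspace_subtopology
    by (intro set_eqI) (simp only: Int_iff mem_Collect_eq conj_absorb conj_left_absorb)
qed

lemma inverse_limit_coordinate: "y \<in> topspace (inverse_limit ZT g) \<Longrightarrow> y n \<in> Z n"
  by (simp add: topspace_inverse_limit)

lemma thread_letter:
  assumes y: "y \<in> topspace (inverse_limit ZT g)"
  shows "thread (letter j y)"
  unfolding thread_def
proof (intro allI conjI)
  fix i
  have wd: "word n (list_decode (y n j))" for n
    using inverse_limit_coordinate[OF y, of n] by (simp add: Z_def vertex_shift_def Sig_def)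
  show "letter j y i \<in> K i"
    using wd[of i] by (simp add: word_def letter_def)
  \<comment> \<open>Neighbouring diagonal entries come from different coordinates. Compatibility
    moves both into coordinate \<open>Suc i\<close>, where they are adjacent entries of one
    word.\<close>
  have "y i = g i (Suc i) (y (Suc i))"
    using y by (simp add: topspace_inverse_limit)
  then have "y i j = trunc i (y (Suc i) j)"
    by (simp add: g_def fun_eq_iff)
  then have "letter j y i = list_decode (y (Suc i) j) ! i"
    by (simp add: letter_def trunc_def)
  then show "R i (letter j y i) (letter j y (Suc i))"
    using wd[of "Suc i"] by (simp add: word_def letter_def)
qed

lemma E_letter:
  assumes y: "y \<in> topspace (inverse_limit ZT g)"
  shows "E i (letter j y i) (letter (Suc j) y i)"
  using inverse_limit_coordinate[OF y, of i]
  by (simp add: Z_def vertex_shift_def step_def letter_def)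

section \<open>The semiconjugacy\<close>

definition \<phi> :: "(nat \<Rightarrow> nat \<Rightarrow> nat) \<Rightarrow> 'a" where
  "\<phi> y = pt (letter 0 y)"

lemma letter_nonempty:
  "y \<in> topspace (inverse_limit ZT g) \<Longrightarrow> V i (letter j y i) \<noteq> {}"
  using E_nonempty E_letter by blast

lemma \<phi>_topspace: "y \<in> topspace (inverse_limit ZT g) \<Longrightarrow> \<phi> y \<in> topspace X"
  unfolding \<phi>_def by (intro pt_in_topspace thread_letter letter_nonempty)

text \<open>The shift turns the thread at time 0 into the thread at time 1, and edges join these two
  at every level.\<close>

lemma \<phi>_equivariant:
  assumes "y \<in> topspace (inverse_limit ZT g)"
  shows "\<phi> (induced_map (\<lambda>n. shift_map) y) = f (\<phi> y)"
proof -
  have "letter 0 (induced_map (\<lambda>n. shift_map) y) = letter (Suc 0) y"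
    by (auto simp: letter_def induced_map_def shift_map_def)
  then show ?thesis
    unfolding \<phi>_def using pt_equivariant[OF thread_letter thread_letter E_letter] assms by metis
qed

text \<open>Itineraries of the orbit of \<open>x\<close> can be chosen independently at all levels:
  sets of adjacent levels that contain the same orbit point satisfy \<open>R\<close>, because
  \<open>V i k\<close> lies in \<open>B i k\<close>.\<close>

lemma \<phi>_onto:
  assumes "x \<in> topspace X"
  shows "\<exists>y\<in>topspace (inverse_limit ZT g). \<phi> y = x"
proof -
  have "\<forall>i. \<exists>k. (\<forall>j. k j \<in> K i) \<and> (\<forall>j. (f ^^ j) x \<in> V i (k j)) \<and> (\<forall>j. E i (k j) (k (Suc j)))"
    using orbit_letters[OF assms] by metis
  then obtain k where k: "\<And>i j. k i j \<in> K i" "\<And>i j. (f ^^ j) x \<in> V i (k i j)"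
      "\<And>i j. E i (k i j) (k i (Suc j))"
    by metis
  have R: "R i (k i j) (k (Suc i) j)" for i j
    using k(2)[of j i] k(2)[of j "Suc i"] V_subset_B[OF k(1)] by (auto simp: R_def)
  define y where "y n j = list_encode (map (\<lambda>i. k i j) [0..<Suc n])" for n j
  have nth: "list_decode (y n j) ! i = k i j" if "i \<le> n" for n i j
    using that by (simp add: y_def del: upt_Suc)
  have "word n (list_decode (y n j))" for n j
    using k(1) R by (auto simp: word_def nth) (simp add: y_def)
  then have "y n \<in> Z n" for n
    using k(3) by (auto simp: Z_def vertex_shift_def Sig_def step_def nth)
  moreover have "y n = g n m (y m)" if "n \<le> m" for n m
    using that by (auto simp: g_def trunc_def y_def take_map simp del: upt_Suc)
  ultimately have y: "y \<in> topspace (inverse_limit ZT g)"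
    by (simp add: topspace_inverse_limit)
  moreover have "\<phi> y = x"
    unfolding \<phi>_def using k(2)[of 0] by (intro pt_eqI_V thread_letter[OF y]) (simp add: letter_def nth)
  ultimately show ?thesis
    by blast
qed

lemma continuous_map_first_letter:
  "continuous_map (inverse_limit ZT g) (discrete_topology (Sig i)) (\<lambda>y. y i 0)"
proof -
  have "continuous_map (product_topology ZT UNIV) (ZT i) (\<lambda>y. y i)"
    by (rule continuous_map_product_projection) simp
  moreover have "continuous_map (ZT i) (discrete_topology (Sig i)) (\<lambda>x. x 0)"
    by (intro continuous_map_from_subtopology continuous_map_full_shift_coordinate)
  ultimately have "continuous_map (product_topology ZT UNIV) (discrete_topology (Sig i)) (\<lambda>y. y i 0)"
    using continuous_map_compose by (fastforce simp: o_def)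
  then show ?thesis
    unfolding inverse_limit_def by (rule continuous_map_from_subtopology)
qed

lemma continuous_map_\<phi>: "continuous_map (inverse_limit ZT g) X \<phi>"
  unfolding continuous_map_def
proof (intro conjI allI impI)
  show "\<phi> \<in> topspace (inverse_limit ZT g) \<rightarrow> topspace X"
    using \<phi>_topspace by blast
  fix G
  assume G: "openin X G"
  show "openin (inverse_limit ZT g) {y \<in> topspace (inverse_limit ZT g). \<phi> y \<in> G}"
  proof (subst openin_subopen, intro ballI)
    fix y
    assume "y \<in> {y \<in> topspace (inverse_limit ZT g). \<phi> y \<in> G}"
    then have y: "y \<in> topspace (inverse_limit ZT g)" "pt (letter 0 y) \<in> G"
      by (auto simp: \<phi>_def)
    then obtain i where i: "clC (letter 0 y) i \<subseteq> G"
      using pt_eventually[OF thread_letter letter_nonempty G] by blast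
    \<comment> \<open>Fixing the first letter of coordinate \<open>i\<close> fixes the index at
      level \<open>i\<close>, so all points of \<open>N\<close> are sent into the same closed set
      \<open>clC (letter 0 y) i\<close>.\<close>
    define N where "N = {y' \<in> topspace (inverse_limit ZT g). y' i 0 \<in> {y i 0}}"
    have "y i 0 \<in> Sig i"
      using inverse_limit_coordinate[OF y(1), of i] by (simp add: Z_def vertex_shift_def)
    then have "openin (inverse_limit ZT g) N"
      unfolding N_def by (intro openin_continuous_map_preimage[OF continuous_map_first_letter]) simp
    moreover have "\<phi> y' \<in> G" if "y' \<in> N" for y'
    proof -
      have "letter 0 y' i = letter 0 y i"
        using that by (simp add: N_def letter_def)
      moreover have "pt (letter 0 y') \<in> clC (letter 0 y') i"
        using that by (intro pt_mem thread_letter letter_nonempty) (auto simp: N_def)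
      ultimately show ?thesis
        using i by (auto simp: \<phi>_def)
    qed
    ultimately show "\<exists>T. openin (inverse_limit ZT g) T \<and> y \<in> T \<and>
        T \<subseteq> {y \<in> topspace (inverse_limit ZT g). \<phi> y \<in> G}"
      using y(1) by (intro exI[of _ N]) (auto simp: N_def)
  qed
qed

lemma semiconjugacy_\<phi>:
  "semiconjugacy (induced_map (\<lambda>n. shift_map)) (inverse_limit ZT g) f X \<phi>"
  unfolding semiconjugacy_def
proof (intro conjI ballI)
  show "\<phi> ` topspace (inverse_limit ZT g) = topspace X"
  proof
    show "\<phi> ` topspace (inverse_limit ZT g) \<subseteq> topspace X"
      using \<phi>_topspace by (rule image_subsetI)
    show "topspace X \<subseteq> \<phi> ` topspace (inverse_limit ZT g)"
    proof
      fix x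
      assume "x \<in> topspace X"
      from \<phi>_onto[OF this] show "x \<in> \<phi> ` topspace (inverse_limit ZT g)"
        by (elim bexE) (rule rev_image_eqI, assumption, erule sym)
    qed
  qed
qed (fact continuous_map_\<phi>, rule \<phi>_equivariant)

lemma shift_of_finite_type_Z: "shift_of_finite_type (Sig n) (Z n)"
  unfolding Z_def by (intro shift_of_finite_type_vertex_shift finite_Sig)

end

theorem theorem20:
  fixes X :: "'a topology" and f :: "'a \<Rightarrow> 'a" and \<U> :: "nat \<Rightarrow> 'a set set"
  assumes "compact_space X" and "Hausdorff_space X"
    and "dynamical_system f X"
    and "has_shadowing f X"
    and "\<And>n. finite_open_cover X (\<U> n)"
    and "\<And>n. witnesses_shadowing X f (\<U> (n + 1)) (\<U> n)"
    and "cofinal_in_TOC X (range \<U>)"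
    and "\<And>n U. U \<in> \<U> (n + 2) \<Longrightarrow> \<exists>W\<in>\<U> n. st U (\<U> (n + 1)) \<subseteq> W"
  shows "\<exists>(\<Sigma> :: nat \<Rightarrow> nat set) (Z :: nat \<Rightarrow> (nat \<Rightarrow> nat) set) g \<phi>.
           (\<forall>n. shift_of_finite_type (\<Sigma> n) (Z n)) \<and>
           inverse_sequence (\<lambda>n. subtopology (full_shift (\<Sigma> n)) (Z n)) (\<lambda>n. shift_map) g \<and>
           semiconjugacy
             (induced_map (\<lambda>n. shift_map))
             (inverse_limit (\<lambda>n. subtopology (full_shift (\<Sigma> n)) (Z n)) g)
             f X \<phi>"
proof -
  define w where "w n U = (SOME W. W \<in> \<U> n \<and> st U (\<U> (Suc n)) \<subseteq> W)" for n U
  have w: "w n U \<in> \<U> n \<and> st U (\<U> (Suc n)) \<subseteq> w n U" if "U \<in> \<U> (Suc (Suc n))" for n U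
  proof -
    have "\<exists>W. W \<in> \<U> n \<and> st U (\<U> (Suc n)) \<subseteq> W"
      using assms(8)[of U n] that by (simp add: Bex_def)
    then show ?thesis
      unfolding w_def by (rule someI_ex)
  qed
  \<comment> \<open>A finite cover is the image of an initial segment of the naturals. Pairing the
    enumeration with its index set allows both to be chosen at once for every level.\<close>
  have "\<exists>p. finite (snd p :: nat set) \<and> fst p ` snd p = \<U> (i + 4)" for i
  proof -
    have "finite (\<U> (i + 4))"
      using assms(5) by (simp add: finite_open_cover_def)
    from finite_imp_nat_seg_image_inj_on[OF this]
    obtain n :: nat and v where "\<U> (i + 4) = v ` {i. i < n}"
      by (elim exE conjE)
    then show ?thesis
      by (intro exI[of _ "(v, {i. i < n})"]) simp
  qed
  then obtain p where p: "\<And>i. finite (snd (p i) :: nat set)" "\<And>i. fst (p i) ` snd (p i) = \<U> (i + 4)"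
    by metis
  interpret shadowing_covers X f \<U> w "\<lambda>i. fst (p i)" "\<lambda>i. snd (p i)"
  proof
    show "continuous_map X X f"
      using assms(3) by (simp add: dynamical_system_def)
    show "witnesses_shadowing X f (\<U> (Suc n)) (\<U> n)" for n
      using assms(6)[of n] by simp
  qed (use assms(1,2,5,7) w p in blast)+
  show ?thesis
    by (intro exI conjI allI) (rule shift_of_finite_type_Z inverse_sequence_ZT semiconjugacy_\<phi>)+
qed

end
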